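(* Let $(E,\tau)$ be a real topological linear space, $\psi:E\to\mathbb{R}$ a seminorm, and $K, A\subseteq E$ nontrivial cones with normlike-bases $B_K$ and $B_A$ (with respect to $\psi$). Define $S_{-K}:=\mathrm{conv}(-B_K)$ and $S_A^0:=\mathrm{conv}(B_A\cup\{0\})$. If one of the following conditions is satisfied: (i) $S_{-K}$ is $\tau$-solid and $S_A^0\cap \mathrm{int}_\tau\,S_{-K}=\emptyset$; (ii) $S_A^0$ is $\tau$-solid and $(\mathrm{int}_\tau\,S_A^0)\cap S_{-K}=\emptyset$; then there exists $(x^*,\alpha)\in K_\tau^{a+}$ with $x^*\neq 0$ such that $$x^*(a)+\alpha\psi(a)\ \geq\ 0\ \geq\ x^*(k)+\alpha\psi(k)\quad\text{for all } a\in A\text{ and } k\in -K.$$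
   Context: $E\neq\{0\}$; $E'$ is the algebraic dual and $E^*=(E,\tau)^*$ the topological dual ($\tau$-continuous linear functionals); $\mathbb{R}_+=[0,\infty)$. A set $K\subseteq E$ is a cone if $0\in K=\mathbb{R}_+\cdot K$ (not necessarily convex); it is nontrivial if $\{0\}\neq K\neq E$. A seminorm is a sublinear symmetric function $\psi:E\to\mathbb{R}$ (not assumed $\tau$-continuous). A nontrivial cone $K$ has a normlike-base (w.r.t. $\psi$) if $\psi(x)>0$ for all $x\in K\setminus\{0\}$; the normlike-base is then $B_K:=\{x\in K\mid \psi(x)=1\}$. All normlike-bases are taken with respect to the same fixed seminorm $\psi$. A set $\Omega\subseteq E$ is $\tau$-solid if its $\tau$-interior $\mathrm{int}_\tau\,\Omega$ is nonempty; $\mathrm{conv}$ denotes the convex hull. $K^+:=\{y'\in E'\mid \forall k\in K:\ y'(k)\geq 0\}$, $K^{a+}:=\{(x',\alpha)\in K^+\times\mathbb{R}_+\mid \forall y\in K:\ x'(y)-\alpha\psi(y)\geq 0\}$ and $K^{a+}_\tau:=K^{a+}\cap(E^*\times\mathbb{R})$. *)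

theory Defs
  imports "HOL-Analysis.Analysis"
begin

text \<open>Real topological linear spaces: addition and scalar multiplication are jointly continuous.
  Neither the Hausdorff property nor local convexity is assumed. The axiom is joint continuity of
  scalar multiplication, stated pointwise in the style of \<^class>\<open>topological_monoid_add\<close>.\<close>

class real_topological_vector = real_vector + topological_ab_group_add +
  assumes tendsto_scaleR_Pair:
    "LIM x (nhds (c :: real) \<times>\<^sub>F nhds a). scaleR (fst x) (snd x) :> nhds (scaleR c a)"

instance real_normed_vector \<subseteq> real_topological_vector
proof
  fix c :: real and a :: 'a
  show "LIM x (nhds c \<times>\<^sub>F nhds a). fst x *\<^sub>R snd x :> nhds (c *\<^sub>R a)"
    by (intro tendsto_scaleR filterlim_fst filterlim_snd)
qed

definition algebraic_dual :: "('a::real_vector \<Rightarrow> real) set" where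
  "algebraic_dual = {f. linear f}"

definition topological_dual :: "('a::real_topological_vector \<Rightarrow> real) set" where
  "topological_dual = {f \<in> algebraic_dual. continuous_on UNIV f}"

definition solid :: "'a::topological_space set \<Rightarrow> bool" where
  "solid \<Omega> \<longleftrightarrow> interior \<Omega> \<noteq> {}"

text \<open>No continuity with respect to the topology of the space is required of a seminorm.\<close>

definition seminorm :: "('a::real_vector \<Rightarrow> real) \<Rightarrow> bool" where
  "seminorm \<psi> \<longleftrightarrow>
    (\<forall>x y. \<psi> (x + y) \<le> \<psi> x + \<psi> y) \<and>
    (\<forall>c x. c \<ge> 0 \<longrightarrow> \<psi> (c *\<^sub>R x) = c * \<psi> x) \<and>
    (\<forall>x. \<psi> (- x) = \<psi> x)"

text \<open>The library's \<^const>\<open>cone\<close> (closure under nonnegative scaling) also holds of the empty set,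
  hence the explicit requirement that \<open>0\<close> belongs to the set.\<close>

definition nontrivial_cone :: "'a::real_vector set \<Rightarrow> bool" where
  "nontrivial_cone K \<longleftrightarrow> cone K \<and> 0 \<in> K \<and> K \<noteq> {0} \<and> K \<noteq> UNIV"

definition has_normlike_base :: "('a::real_vector \<Rightarrow> real) \<Rightarrow> 'a set \<Rightarrow> bool" where
  "has_normlike_base \<psi> K \<longleftrightarrow> (\<forall>x \<in> K - {0}. \<psi> x > 0)"

definition normlike_base :: "('a::real_vector \<Rightarrow> real) \<Rightarrow> 'a set \<Rightarrow> 'a set" where
  "normlike_base \<psi> K = {x \<in> K. \<psi> x = 1}"

definition S_neg :: "('a::real_vector \<Rightarrow> real) \<Rightarrow> 'a set \<Rightarrow> 'a set" where
  "S_neg \<psi> K = convex hull (uminus ` normlike_base \<psi> K)"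

definition S_zero :: "('a::real_vector \<Rightarrow> real) \<Rightarrow> 'a set \<Rightarrow> 'a set" where
  "S_zero \<psi> A = convex hull (normlike_base \<psi> A \<union> {0})"

definition dual_cone :: "'a::real_vector set \<Rightarrow> ('a \<Rightarrow> real) set" where
  "dual_cone K = {y' \<in> algebraic_dual. \<forall>k\<in>K. y' k \<ge> 0}"

definition augmented_dual_cone ::
  "('a::real_vector \<Rightarrow> real) \<Rightarrow> 'a set \<Rightarrow> (('a \<Rightarrow> real) \<times> real) set" where
  "augmented_dual_cone \<psi> K =
    {(x', \<alpha>). x' \<in> dual_cone K \<and> \<alpha> \<ge> 0 \<and> (\<forall>y\<in>K. x' y - \<alpha> * \<psi> y \<ge> 0)}"

definition topological_augmented_dual_cone ::
  "('a::real_topological_vector \<Rightarrow> real) \<Rightarrow> 'a set \<Rightarrow> (('a \<Rightarrow> real) \<times> real) set" where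
  "topological_augmented_dual_cone \<psi> K =
    augmented_dual_cone \<psi> K \<inter> (topological_dual \<times> UNIV)"

end

theory Submission
  imports Defs
begin

text \<open>A convex set that misses the interior of another one can be separated from it by a
  continuous functional \<open>f\<close>. Applied to the two hulls this yields \<open>f \<le> c\<close> on \<open>-B\<^sub>K\<close> and
  \<open>f \<ge> c\<close> on \<open>B\<^sub>A \<union> {0}\<close>. The point \<open>0\<close> forces \<open>c \<le> 0\<close>, so \<open>\<alpha> = -c\<close> is admissible, and since
  \<open>\<psi> = 1\<close> on the bases the claim follows by homogeneity.

  Separation is obtained without local convexity: a convex set that does not contain \<open>0\<close> but has
  an interior point \<open>e\<close> spans a convex cone \<open>C\<close>, and \<open>x \<mapsto> inf {t. t e - x \<in> C}\<close> is
  sublinear. A minimal sublinear functional below it is linear and nonnegative on \<open>C\<close>, hence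
  continuous, because it is bounded below near \<open>e\<close>.\<close>

section \<open>Sublinear functionals\<close>

text \<open>Requiring only \<open>\<le>\<close>, and only for \<open>c > 0\<close>, keeps the
  property easy to verify for infima. Equality follows by applying the bound to
  \<open>inverse c\<close> as well, and the value at 0 from \<open>q 0 = 2 * q 0\<close>.\<close>

definition sublinear :: "('a::real_vector \<Rightarrow> real) \<Rightarrow> bool" where
  "sublinear q \<longleftrightarrow>
    (\<forall>x y. q (x + y) \<le> q x + q y) \<and> (\<forall>c x. c > 0 \<longrightarrow> q (c *\<^sub>R x) \<le> c * q x)"

lemma sublinear_add: "sublinear q \<Longrightarrow> q (x + y) \<le> q x + q y"
  by (simp add: sublinear_def)

lemma sublinear_scaleR:
  assumes "sublinear q" "c > 0"
  shows "q (c *\<^sub>R x) = c * q x"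
proof (rule antisym)
  show "q (c *\<^sub>R x) \<le> c * q x"
    using assms by (simp add: sublinear_def)
  have "q (inverse c *\<^sub>R (c *\<^sub>R x)) \<le> inverse c * q (c *\<^sub>R x)"
    using assms by (simp only: sublinear_def inverse_positive_iff_positive)
  then show "c * q x \<le> q (c *\<^sub>R x)"
    using assms(2) by (simp add: field_simps)
qed

lemma sublinear_0: "sublinear q \<Longrightarrow> q 0 = 0"
  using sublinear_scaleR[of q 2 0] by simp

lemma sublinear_minus: "sublinear q \<Longrightarrow> - q (- x) \<le> q x"
  using sublinear_add[of q x "- x"] sublinear_0[of q] by simp

text \<open>Serves three constructions: the infimum of a chain, a perturbation along a direction,
  and the gauge of a cone. The infimum over \<open>t\<close> is taken with \<open>s\<close> fixed,
  then the one over \<open>s\<close>.\<close>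

lemma sublinear_Inf:
  fixes S :: "'a::real_vector \<Rightarrow> real set"
  assumes ne: "\<And>x. S x \<noteq> {}" and bdd: "\<And>x. bdd_below (S x)"
    and add: "\<And>x y s t. s \<in> S x \<Longrightarrow> t \<in> S y \<Longrightarrow> \<exists>u\<in>S (x + y). u \<le> s + t"
    and scale: "\<And>c x t. c > 0 \<Longrightarrow> t \<in> S x \<Longrightarrow> \<exists>u\<in>S (c *\<^sub>R x). u \<le> c * t"
  shows "sublinear (\<lambda>x. Inf (S x))"
  unfolding sublinear_def
proof (intro conjI allI impI)
  fix x y
  have *: "Inf (S (x + y)) \<le> s + t" if "s \<in> S x" "t \<in> S y" for s t
    using add[OF that] bdd[of "x + y"] by (meson cInf_lower order_trans)
  have "Inf (S (x + y)) - s \<le> Inf (S y)" if "s \<in> S x" for s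
    using *[OF that] by (intro cInf_greatest[OF ne]) (simp add: algebra_simps)
  then have "Inf (S (x + y)) - Inf (S y) \<le> Inf (S x)"
    by (intro cInf_greatest[OF ne]) (simp add: algebra_simps)
  then show "Inf (S (x + y)) \<le> Inf (S x) + Inf (S y)"
    by simp
next
  fix c :: real and x
  assume c: "c > 0"
  have "Inf (S (c *\<^sub>R x)) / c \<le> t" if "t \<in> S x" for t
  proof -
    have "Inf (S (c *\<^sub>R x)) \<le> c * t"
      using scale[OF c that] bdd[of "c *\<^sub>R x"] by (meson cInf_lower order_trans)
    then show ?thesis
      using c by (simp add: field_simps)
  qed
  then have "Inf (S (c *\<^sub>R x)) / c \<le> Inf (S x)"
    by (intro cInf_greatest[OF ne])
  then show "Inf (S (c *\<^sub>R x)) \<le> c * Inf (S x)"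
    using c by (simp add: field_simps)
qed

section \<open>Algebraic Hahn-Banach theorem by Zorn's lemma\<close>

text \<open>Zorn's lemma for the reversed pointwise order: a nonempty chain has its pointwise
  infimum as a bound.\<close>

lemma exists_minimal_sublinear_below:
  fixes p :: "'a::real_vector \<Rightarrow> real"
  assumes p: "sublinear p"
  obtains q where "sublinear q" "q \<le> p" "\<And>r. sublinear r \<Longrightarrow> r \<le> q \<Longrightarrow> r = q"
proof -
  define Q where "Q = {q. sublinear q \<and> q \<le> p}"
  have "\<exists>m\<in>Q. \<forall>r\<in>Q. r \<le> m \<longrightarrow> r = m"
  proof (rule predicate_Zorn)
    show "partial_order_on Q (relation_of (\<lambda>q r. r \<le> q) Q)"
      by (rule partial_order_on_relation_ofI) auto
  next
    fix \<C>
    assume ch: "\<C> \<in> Chains (relation_of (\<lambda>q r. r \<le> q) Q)"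
    then have sub: "\<C> \<subseteq> Q"
      by (auto simp: Chains_def relation_of_def)
    have tot: "q \<le> r \<or> r \<le> q" if "q \<in> \<C>" "r \<in> \<C>" for q r
      using ch that by (auto simp: Chains_def relation_of_def)
    show "\<exists>u\<in>Q. \<forall>q\<in>\<C>. u \<le> q"
    proof (cases "\<C> = {}")
      case True
      then show ?thesis
        using p by (auto simp: Q_def)
    next
      case False
      define S where "S x = (\<lambda>q. q x) ` \<C>" for x
      \<comment> \<open>The bound is the same for every member:
        \<open>q x \<ge> - q (- x) \<ge> - p (- x)\<close>.\<close>
      have bdd: "bdd_below (S x)" for x
      proof (rule bdd_belowI)
        fix t
        assume "t \<in> S x"
        then obtain q where q: "q \<in> \<C>" "t = q x"
          by (auto simp: S_def)
        with sub have "sublinear q" "q (- x) \<le> p (- x)"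
          by (auto simp: Q_def le_fun_def)
        then show "- p (- x) \<le> t"
          using sublinear_minus[of q x] q(2) by simp
      qed
      have lower: "Inf (S x) \<le> q x" if "q \<in> \<C>" for q x
        using that bdd by (intro cInf_lower) (auto simp: S_def)
      have "sublinear (\<lambda>x. Inf (S x))"
      proof (rule sublinear_Inf)
        show "S x \<noteq> {}" for x
          using False by (simp add: S_def)
        show "bdd_below (S x)" for x
          by (rule bdd)
        fix x y s t
        assume "s \<in> S x" "t \<in> S y"
        then obtain q r where qr: "q \<in> \<C>" "s = q x" "r \<in> \<C>" "t = r y"
          by (auto simp: S_def)
        \<comment> \<open>Chain members are comparable, so the smaller of \<open>q\<close> and
          \<open>r\<close> serves both arguments.\<close>
        obtain m where m: "m \<in> \<C>" "m \<le> q" "m \<le> r"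
          using tot[OF qr(1,3)] qr by blast
        have "sublinear m"
          using m sub by (auto simp: Q_def)
        then have "m (x + y) \<le> m x + m y"
          by (rule sublinear_add)
        also have "\<dots> \<le> s + t"
          using m qr by (simp add: le_fun_def add_mono)
        finally show "\<exists>u\<in>S (x + y). u \<le> s + t"
          using m by (auto simp: S_def)
      next
        fix c :: real and x t
        assume "c > 0" "t \<in> S x"
        then show "\<exists>u\<in>S (c *\<^sub>R x). u \<le> c * t"
          using sub by (auto simp: S_def Q_def sublinear_def)
      qed
      moreover have "(\<lambda>x. Inf (S x)) \<le> p"
      proof -
        obtain q where "q \<in> \<C>"
          using False by blast
        then have "(\<lambda>x. Inf (S x)) \<le> q" "q \<le> p"
          using lower sub by (auto simp: Q_def le_fun_def)
        then show ?thesis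
          by (rule order_trans)
      qed
      ultimately show ?thesis
        using lower by (intro bexI[of _ "\<lambda>x. Inf (S x)"]) (auto simp: Q_def le_fun_def)
    qed
  qed
  then obtain q where q: "q \<in> Q" and min: "\<And>r. r \<in> Q \<Longrightarrow> r \<le> q \<Longrightarrow> r = q"
    by blast
  show thesis
  proof (rule that)
    show "sublinear q" "q \<le> p"
      using q by (auto simp: Q_def)
    show "r = q" if "sublinear r" "r \<le> q" for r
      using that q by (intro min) (auto simp: Q_def intro: order_trans)
  qed
qed

text \<open>The infimum of \<open>q (x + t *\<^sub>R z) - t * q z\<close> over
  \<open>t \<ge> 0\<close> is sublinear and, by \<open>t = 0\<close>, below \<open>q\<close>.
  Minimality makes it equal to \<open>q\<close>, and \<open>t = 1\<close> then gives the
  claim.\<close>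

lemma minimal_sublinear_superadditive:
  fixes q :: "'a::real_vector \<Rightarrow> real"
  assumes q: "sublinear q" and min: "\<And>r. sublinear r \<Longrightarrow> r \<le> q \<Longrightarrow> r = q"
  shows "q x + q z \<le> q (x + z)"
proof -
  define S where "S x = (\<lambda>t. q (x + t *\<^sub>R z) - t * q z) ` {0..}" for x
  have scale: "q (t *\<^sub>R y) = t * q y" if "t \<ge> 0" for t y
    using that sublinear_scaleR[OF q, of t y] sublinear_0[OF q] by (cases "t = 0") auto
  have bdd: "bdd_below (S x)" for x
  proof (rule bdd_belowI)
    fix s
    assume "s \<in> S x"
    then obtain t where t: "t \<ge> 0" "s = q (x + t *\<^sub>R z) - t * q z"
      by (auto simp: S_def)
    \<comment> \<open>Subadditivity for
      \<open>t *\<^sub>R z = (x + t *\<^sub>R z) + (- x)\<close>.\<close>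
    show "- q (- x) \<le> s"
      using sublinear_add[OF q, of "x + t *\<^sub>R z" "- x"] scale[OF t(1), of z] t(2) by simp
  qed
  have lower: "Inf (S x) \<le> q (x + t *\<^sub>R z) - t * q z" if "t \<ge> 0" for x t
    using that bdd by (intro cInf_lower) (auto simp: S_def)
  have "sublinear (\<lambda>x. Inf (S x))"
  proof (rule sublinear_Inf)
    show "S x \<noteq> {}" for x
      by (auto simp: S_def)
    show "bdd_below (S x)" for x
      by (rule bdd)
    fix x y a b
    assume "a \<in> S x" "b \<in> S y"
    then obtain s t where st: "s \<ge> 0" "a = q (x + s *\<^sub>R z) - s * q z"
        "t \<ge> 0" "b = q (y + t *\<^sub>R z) - t * q z"
      by (auto simp: S_def)
    have "q ((x + y) + (s + t) *\<^sub>R z) \<le> q (x + s *\<^sub>R z) + q (y + t *\<^sub>R z)"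
      using sublinear_add[OF q, of "x + s *\<^sub>R z" "y + t *\<^sub>R z"] by (simp add: algebra_simps)
    then show "\<exists>u\<in>S (x + y). u \<le> a + b"
      unfolding S_def using st by (intro bexI[OF _ imageI[of "s + t"]]) (auto simp: algebra_simps)
  next
    fix c :: real and x a
    assume c: "c > 0" and "a \<in> S x"
    then obtain t where t: "t \<ge> 0" "a = q (x + t *\<^sub>R z) - t * q z"
      by (auto simp: S_def)
    have "q (c *\<^sub>R x + (c * t) *\<^sub>R z) = c * q (x + t *\<^sub>R z)"
      using sublinear_scaleR[OF q c, of "x + t *\<^sub>R z"] by (simp add: algebra_simps)
    then show "\<exists>u\<in>S (c *\<^sub>R x). u \<le> c * a"
      unfolding S_def using t c by (intro bexI[OF _ imageI[of "c * t"]]) (auto simp: right_diff_distrib mult.assoc)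
  qed
  moreover have "(\<lambda>x. Inf (S x)) \<le> q"
    using lower[of 0] by (simp add: le_fun_def)
  ultimately have "(\<lambda>x. Inf (S x)) = q"
    by (rule min)
  then show ?thesis
    using lower[of 1 x] by (auto simp: fun_eq_iff)
qed

text \<open>A minimal sublinear functional is both sub- and superadditive, hence additive and odd;
  oddness extends homogeneity to negative scalars.\<close>

theorem exists_linear_le_sublinear:
  fixes p :: "'a::real_vector \<Rightarrow> real"
  assumes "sublinear p"
  obtains f where "linear f" "f \<le> p"
proof -
  obtain q where q: "sublinear q" "q \<le> p" and min: "\<And>r. sublinear r \<Longrightarrow> r \<le> q \<Longrightarrow> r = q"
    using exists_minimal_sublinear_below[OF assms] by blast
  have add: "q (x + y) = q x + q y" for x y
    using sublinear_add[OF q(1)] minimal_sublinear_superadditive[OF q(1) min] by (meson antisym)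
  have neg: "q (- x) = - q x" for x
    using add[of x "- x"] sublinear_0[OF q(1)] by simp
  have "q (c *\<^sub>R x) = c * q x" for c x
    using sublinear_scaleR[OF q(1), of c x] sublinear_scaleR[OF q(1), of "- c" x]
      sublinear_0[OF q(1)] neg[of "c *\<^sub>R x"]
    by (cases c "0::real" rule: linorder_cases) auto
  then have "linear q"
    by (intro linearI) (auto simp: add)
  then show thesis
    using q(2) that by blast
qed

section \<open>Separation in topological linear spaces\<close>

lemma tendsto_scaleR_topological_vector:
  fixes g :: "'b \<Rightarrow> 'a::real_topological_vector"
  assumes "(f \<longlongrightarrow> c) F" "(g \<longlongrightarrow> a) F"
  shows "((\<lambda>x. f x *\<^sub>R g x) \<longlongrightarrow> c *\<^sub>R a) F"
  using filterlim_compose[OF tendsto_scaleR_Pair filterlim_Pair[OF assms]] by simp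

lemma continuous_on_scaleR_topological_vector:
  fixes g :: "'b::topological_space \<Rightarrow> 'a::real_topological_vector"
  assumes "continuous_on S f" "continuous_on S g"
  shows "continuous_on S (\<lambda>x. f x *\<^sub>R g x)"
  using assms by (auto simp: continuous_on_def intro: tendsto_scaleR_topological_vector)

lemmas continuous_on_affine = continuous_on_add continuous_on_diff continuous_on_const
  continuous_on_id continuous_on_scaleR_topological_vector

section \<open>Interiors of convex sets and continuity of functionals\<close>

lemma convex_combination_interior:
  fixes S :: "'a::real_topological_vector set"
  assumes "convex S" "p \<in> interior S" "s \<in> S" "0 < t" "t \<le> 1"
  shows "t *\<^sub>R p + (1 - t) *\<^sub>R s \<in> interior S"
proof -
  \<comment> \<open>\<open>h\<close> inverts the homothety with centre \<open>s\<close> and ratio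
    \<open>t\<close>. The preimage of \<open>interior S\<close> under \<open>h\<close> is thus the
    homothetic copy of \<open>interior S\<close>, which convexity keeps inside
    \<open>S\<close>.\<close>
  define h where "h x = (1 / t) *\<^sub>R (x - (1 - t) *\<^sub>R s)" for x
  have "continuous_on UNIV h"
    unfolding h_def by (intro continuous_on_affine)
  then have "open (h -` interior S)"
    by (rule open_vimage[OF open_interior])
  moreover have "h -` interior S \<subseteq> S"
  proof
    fix x
    assume "x \<in> h -` interior S"
    then have "h x \<in> S"
      using interior_subset by auto
    then have "t *\<^sub>R h x + (1 - t) *\<^sub>R s \<in> S"
      using assms by (intro convexD) auto
    then show "x \<in> S"
      using assms by (simp add: h_def)
  qed
  moreover have "t *\<^sub>R p + (1 - t) *\<^sub>R s \<in> h -` interior S"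
    using assms by (simp add: h_def)
  ultimately show ?thesis
    by (meson interiorI)
qed

lemma convex_interior_topological_vector:
  fixes S :: "'a::real_topological_vector set"
  assumes "convex S"
  shows "convex (interior S)"
proof (rule convexI)
  fix x y and u v :: real
  assume *: "x \<in> interior S" "y \<in> interior S" "0 \<le> u" "0 \<le> v" "u + v = 1"
  then have v: "v = 1 - u" and "y \<in> S"
    using interior_subset by auto
  then show "u *\<^sub>R x + v *\<^sub>R y \<in> interior S"
    using convex_combination_interior[OF assms *(1), of y u] * unfolding v by (cases "u = 0") auto
qed

text \<open>Nonnegativity at both \<open>e + v\<close> and \<open>e - v\<close> gives
  \<open>\<bar>f v\<bar> \<le> f e\<close>, so \<open>f\<close> is bounded on a neighbourhood of
  0.\<close>

lemma linear_nonneg_imp_continuous: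
  fixes f :: "'a::real_topological_vector \<Rightarrow> real"
  assumes f: "linear f" and e: "e \<in> interior G" and nonneg: "\<And>x. x \<in> G \<Longrightarrow> f x \<ge> 0"
  shows "continuous_on UNIV f"
  unfolding continuous_on_def tendsto_iff
proof (intro ballI allI impI)
  fix x and \<epsilon> :: real
  assume \<epsilon>: "\<epsilon> > 0"
  have fe: "f e \<ge> 0"
    using e interior_subset nonneg by blast
  \<comment> \<open>Chosen so that \<open>k * \<epsilon> = f e + 1\<close>; the summand 1 keeps
    \<open>k\<close> positive when \<open>f e = 0\<close> and makes the final estimate
    strict.\<close>
  define k where "k = (f e + 1) / \<epsilon>"
  have k: "k > 0"
    using fe \<epsilon> by (simp add: k_def)
  define U where "U = (\<lambda>y. e + k *\<^sub>R (y - x)) -` interior G \<inter> (\<lambda>y. e - k *\<^sub>R (y - x)) -` interior G"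
  have "open U"
    unfolding U_def by (intro open_Int open_vimage open_interior continuous_on_affine)
  moreover have "x \<in> U"
    using e by (simp add: U_def)
  moreover have "dist (f y) (f x) < \<epsilon>" if "y \<in> U" for y
  proof -
    have "f (e + k *\<^sub>R (y - x)) \<ge> 0" "f (e - k *\<^sub>R (y - x)) \<ge> 0"
      using that interior_subset nonneg unfolding U_def by blast+
    then have "\<bar>k * (f y - f x)\<bar> \<le> f e"
      by (simp add: linear_add[OF f] linear_diff[OF f] linear_scale[OF f])
    then have "k * \<bar>f y - f x\<bar> \<le> f e"
      using k by (simp add: abs_mult)
    also have "\<dots> < k * \<epsilon>"
      using \<epsilon> by (simp add: k_def)
    finally show ?thesis
      using k by (simp add: dist_real_def)
  qed
  ultimately show "\<forall>\<^sub>F y in at x. dist (f y) (f x) < \<epsilon>"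
    unfolding eventually_at_topological by blast
qed

lemma interior_absorbing:
  fixes G :: "'a::real_topological_vector set"
  assumes "e \<in> interior G"
  obtains s where "s > 0" "e - s *\<^sub>R x \<in> G"
proof -
  have "continuous_on UNIV (\<lambda>s::real. e - s *\<^sub>R x)"
    by (intro continuous_on_affine)
  then have "open ((\<lambda>s::real. e - s *\<^sub>R x) -` interior G)"
    by (rule open_vimage[OF open_interior])
  moreover have "0 \<in> (\<lambda>s::real. e - s *\<^sub>R x) -` interior G"
    using assms by simp
  ultimately obtain d where d: "d > 0" "ball 0 d \<subseteq> (\<lambda>s::real. e - s *\<^sub>R x) -` interior G"
    using open_contains_ball by blast
  have "d / 2 \<in> ball 0 d"
    using d(1) by simp
  then have "e - (d / 2) *\<^sub>R x \<in> G"
    using d(2) interior_subset by blast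
  then show thesis
    using d(1) that[of "d / 2"] by simp
qed

section \<open>Separation by a continuous functional\<close>

lemma convex_nonneg_functional:
  fixes G :: "'a::real_topological_vector set"
  assumes G: "convex G" "0 \<notin> G" and e: "e \<in> interior G"
  obtains f :: "'a \<Rightarrow> real"
    where "linear f" "continuous_on UNIV f" "f e > 0" "\<And>x. x \<in> G \<Longrightarrow> f x \<ge> 0"
proof -
  \<comment> \<open>Only strictly positive multiples are taken, so that 0 stays outside
    \<open>C\<close>.\<close>
  define C where "C = {t *\<^sub>R g | t g. t > 0 \<and> g \<in> G}"
  have eG: "e \<in> G"
    using e interior_subset by blast
  have CI: "t *\<^sub>R g \<in> C" if "t > 0" "g \<in> G" for t g
    using that by (auto simp: C_def)
  have C0: "0 \<notin> C"
    using G(2) by (auto simp: C_def)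
  have Cscale: "c *\<^sub>R x \<in> C" if "c > 0" "x \<in> C" for c x
    using that by (force simp: C_def intro: mult_pos_pos)
  have Cadd: "x + y \<in> C" if xy: "x \<in> C" "y \<in> C" for x y
  proof -
    obtain s g t h where *: "s > 0" "g \<in> G" "x = s *\<^sub>R g" "t > 0" "h \<in> G" "y = t *\<^sub>R h"
      using xy by (auto simp: C_def)
    \<comment> \<open>Dividing \<open>x + y\<close> by \<open>s + t\<close> leaves a convex
      combination of \<open>g\<close> and \<open>h\<close>.\<close>
    have "(s / (s + t)) *\<^sub>R g + (t / (s + t)) *\<^sub>R h \<in> G"
      using * by (intro convexD[OF G(1)]) (auto simp flip: add_divide_distrib)
    then have "(s + t) *\<^sub>R ((s / (s + t)) *\<^sub>R g + (t / (s + t)) *\<^sub>R h) \<in> C"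
      using * by (intro CI) auto
    moreover have "(s + t) *\<^sub>R ((s / (s + t)) *\<^sub>R g + (t / (s + t)) *\<^sub>R h) = x + y"
      using * by (simp add: scaleR_add_right)
    ultimately show ?thesis
      by simp
  qed
  \<comment> \<open>For \<open>t < 0\<close>, both \<open>t *\<^sub>R e\<close> and its negative
    would lie in \<open>C\<close>, and so would their sum 0.\<close>
  have pos: "t > 0" if "t *\<^sub>R e \<in> C" for t
  proof (rule ccontr)
    assume "\<not> t > 0"
    moreover have "t \<noteq> 0"
      using that C0 by auto
    ultimately have "(- t) *\<^sub>R e \<in> C"
      by (intro CI eG) simp
    then show False
      using Cadd[OF that] C0 by fastforce
  qed
  have absorb: "\<exists>t. t *\<^sub>R e - x \<in> C" for x
  proof -
    obtain s where s: "s > 0" "e - s *\<^sub>R x \<in> G"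
      using interior_absorbing[OF e] by blast
    then have "(1 / s) *\<^sub>R (e - s *\<^sub>R x) \<in> C"
      by (intro CI) auto
    then show ?thesis
      using s by (auto simp: scaleR_diff_right intro!: exI[of _ "1 / s"])
  qed
  define S where "S x = {t. t *\<^sub>R e - x \<in> C}" for x
  have bdd: "bdd_below (S x)" for x
  proof -
    \<comment> \<open>A witness \<open>s\<close> for \<open>- x\<close> bounds every
      \<open>t\<close> in \<open>S x\<close>: adding the two elements of \<open>C\<close> gives
      \<open>(t + s) *\<^sub>R e\<close>, hence \<open>t + s > 0\<close>.\<close>
    obtain s where s: "s *\<^sub>R e - (- x) \<in> C"
      using absorb by blast
    show ?thesis
    proof (rule bdd_belowI)
      fix t
      assume "t \<in> S x"
      then have "(t + s) *\<^sub>R e \<in> C"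
        using Cadd[of "t *\<^sub>R e - x", OF _ s] by (simp add: S_def algebra_simps)
      then show "- s \<le> t"
        using pos by fastforce
    qed
  qed
  have "sublinear (\<lambda>x. Inf (S x))"
  proof (rule sublinear_Inf)
    show "S x \<noteq> {}" for x
      using absorb by (auto simp: S_def)
    show "bdd_below (S x)" for x
      by (rule bdd)
    show "\<exists>u\<in>S (x + y). u \<le> s + t" if "s \<in> S x" "t \<in> S y" for x y s t
      using Cadd[of "s *\<^sub>R e - x" "t *\<^sub>R e - y"] that
      by (intro bexI[of _ "s + t"]) (auto simp: S_def algebra_simps)
    show "\<exists>u\<in>S (c *\<^sub>R x). u \<le> c * t" if "c > 0" "t \<in> S x" for c x t
      using Cscale[of c "t *\<^sub>R e - x"] that
      by (intro bexI[of _ "c * t"]) (auto simp: S_def algebra_simps)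
  qed
  then obtain f where f: "linear f" "f \<le> (\<lambda>x. Inf (S x))"
    by (rule exists_linear_le_sublinear)
  have le: "f x \<le> t" if "t *\<^sub>R e - x \<in> C" for x t
    using f(2) cInf_lower[OF _ bdd, of t x] that by (force simp: S_def le_fun_def intro: order_trans)
  \<comment> \<open>For \<open>x \<in> G\<close> the value 0 belongs to \<open>S (- x)\<close>, so
    \<open>f (- x) \<le> 0\<close>.\<close>
  have nonneg: "f x \<ge> 0" if "x \<in> G" for x
    using le[of 0 "- x"] CI[of 1 x] that by (simp add: linear_neg[OF f(1)])
  \<comment> \<open>The value \<open>- (1/2)\<close> is one choice in \<open>S (- e)\<close>: any
    \<open>t\<close> with \<open>-1 < t < 0\<close> shows \<open>f (- e) < 0\<close>.\<close>
  have "(- (1/2)) *\<^sub>R e - (- e) = (1/2) *\<^sub>R e"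
    by (simp add: algebra_simps flip: scaleR_add_left)
  then have "f (- e) \<le> - (1/2)"
    using le[of "- (1/2)" "- e"] CI[of "1/2" e] eG by simp
  then have "f e > 0"
    by (simp add: linear_neg[OF f(1)])
  then show thesis
    using that f(1) linear_nonneg_imp_continuous[OF f(1) e nonneg] nonneg by blast
qed

text \<open>Disjointness says that 0 is no difference \<open>d - s\<close> with \<open>s\<close> in
  the interior. These differences form a convex set with interior points, and a functional
  nonnegative on it separates \<open>D\<close> from \<open>interior \<Omega>\<close>.\<close>

theorem separating_functional_interior:
  fixes \<Omega> D :: "'a::real_topological_vector set"
  assumes \<Omega>: "convex \<Omega>" "interior \<Omega> \<noteq> {}" and D: "convex D" "D \<noteq> {}"
    and disj: "D \<inter> interior \<Omega> = {}"
  obtains f :: "'a \<Rightarrow> real" and c where "linear f" "continuous_on UNIV f" "f \<noteq> (\<lambda>x. 0)"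
    "\<And>s. s \<in> \<Omega> \<Longrightarrow> f s \<le> c" "\<And>d. d \<in> D \<Longrightarrow> c \<le> f d"
proof -
  define G where "G = {d - s | d s. d \<in> D \<and> s \<in> interior \<Omega>}"
  obtain p d\<^sub>0 where p: "p \<in> interior \<Omega>" and d\<^sub>0: "d\<^sub>0 \<in> D"
    using \<Omega> D by blast
  have "convex G"
  proof -
    have "G = (\<Union>d\<in>D. \<Union>s\<in>interior \<Omega>. {d - s})"
      by (auto simp: G_def)
    then show ?thesis
      using convex_differences[OF D(1) convex_interior_topological_vector[OF \<Omega>(1)]] by simp
  qed
  moreover have "0 \<notin> G"
    using disj by (auto simp: G_def)
  \<comment> \<open>A single \<open>d\<^sub>0\<close> suffices: reflecting and translating
    \<open>interior \<Omega>\<close> gives an open subset of \<open>G\<close>.\<close>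
  moreover have "d\<^sub>0 - p \<in> interior G"
  proof (rule interiorI)
    show "open ((\<lambda>x. d\<^sub>0 - x) -` interior \<Omega>)"
      by (intro open_vimage open_interior continuous_on_affine)
    show "d\<^sub>0 - p \<in> (\<lambda>x. d\<^sub>0 - x) -` interior \<Omega>"
      using p by simp
    show "(\<lambda>x. d\<^sub>0 - x) -` interior \<Omega> \<subseteq> G"
      using d\<^sub>0 by (force simp: G_def)
  qed
  ultimately obtain f :: "'a \<Rightarrow> real" where f: "linear f" "continuous_on UNIV f" "f (d\<^sub>0 - p) > 0"
    and nonneg: "\<And>x. x \<in> G \<Longrightarrow> f x \<ge> 0"
    by (rule convex_nonneg_functional) blast
  have int_le: "f s \<le> f d" if "s \<in> interior \<Omega>" "d \<in> D" for s d
  proof -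
    have "d - s \<in> G"
      using that by (auto simp: G_def)
    then show ?thesis
      using nonneg[of "d - s"] by (simp add: linear_diff[OF f(1)])
  qed
  \<comment> \<open>Passage from the interior to all of \<open>\<Omega>\<close>: apart from
    \<open>s\<close>, the segment from \<open>s\<close> to \<open>p\<close> is interior, and
    \<open>f\<close> along it tends to \<open>f s\<close>.\<close>
  have le: "f s \<le> f d" if s: "s \<in> \<Omega>" and d: "d \<in> D" for s d
  proof (rule tendsto_upperbound)
    show "((\<lambda>t. t * f p + (1 - t) * f s) \<longlongrightarrow> f s) (at_right 0)"
      by (auto intro!: tendsto_eq_intros)
    show "\<forall>\<^sub>F t in at_right 0. t * f p + (1 - t) * f s \<le> f d"
      unfolding eventually_at_right_field
    proof (intro exI[of _ 1] conjI allI impI)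
      fix t :: real
      assume "0 < t" "t < 1"
      then show "t * f p + (1 - t) * f s \<le> f d"
        using int_le[OF convex_combination_interior[OF \<Omega>(1) p s, of t] d]
        by (simp add: linear_add[OF f(1)] linear_scale[OF f(1)])
    qed simp
  qed simp
  show thesis
  proof (rule that[OF f(1,2)])
    show "f \<noteq> (\<lambda>x. 0)"
      using f(3) by auto
    \<comment> \<open>The separating constant is the infimum of \<open>f\<close> over
      \<open>D\<close>, which \<open>f p\<close> bounds from below.\<close>
    show "f s \<le> Inf (f ` D)" if "s \<in> \<Omega>" for s
      using le[OF that] D(2) by (intro cInf_greatest) auto
    have "p \<in> \<Omega>"
      using p interior_subset by blast
    then show "Inf (f ` D) \<le> f d" if "d \<in> D" for d
      using le that by (intro cInf_lower bdd_belowI[of _ "f p"]) auto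
  qed
qed

section \<open>Cones with normlike bases\<close>

lemma seminorm_0: "seminorm \<psi> \<Longrightarrow> \<psi> 0 = 0"
  unfolding seminorm_def by (metis mult_zero_left order_refl scaleR_zero_left)

lemma normlike_base_decomposition:
  assumes "seminorm \<psi>" "nontrivial_cone K" "has_normlike_base \<psi> K" "x \<in> K" "x \<noteq> 0"
  obtains b where "b \<in> normlike_base \<psi> K" "x = \<psi> x *\<^sub>R b" "\<psi> x > 0"
proof -
  have pos: "\<psi> x > 0"
    using assms by (simp add: has_normlike_base_def)
  moreover have "inverse (\<psi> x) *\<^sub>R x \<in> normlike_base \<psi> K"
    using assms pos by (simp add: normlike_base_def seminorm_def nontrivial_cone_def cone_def)
  ultimately show thesis
    using that[of "inverse (\<psi> x) *\<^sub>R x"] by simp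
qed

lemma normlike_base_nonempty:
  assumes "seminorm \<psi>" "nontrivial_cone K" "has_normlike_base \<psi> K"
  shows "normlike_base \<psi> K \<noteq> {}"
proof -
  obtain x where "x \<in> K" "x \<noteq> 0"
    using assms(2) by (auto simp: nontrivial_cone_def)
  then show ?thesis
    using normlike_base_decomposition[OF assms] by blast
qed

text \<open>Each nonzero \<open>x\<close> is \<open>\<psi> x\<close> times a base point. The sign of
  \<open>c\<close> is left open because the bound is used with a nonpositive constant on
  \<open>A\<close> and its negative on \<open>K\<close>.\<close>

lemma linear_ge_on_cone_if_ge_on_base:
  fixes f :: "'a::real_vector \<Rightarrow> real"
  assumes "seminorm \<psi>" "nontrivial_cone K" "has_normlike_base \<psi> K" "linear f"
    and base: "\<And>b. b \<in> normlike_base \<psi> K \<Longrightarrow> c \<le> f b" and "x \<in> K"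
  shows "c * \<psi> x \<le> f x"
proof (cases "x = 0")
  case True
  then show ?thesis
    using assms(4) by (simp add: seminorm_0[OF assms(1)] linear_0)
next
  case False
  then obtain b where b: "b \<in> normlike_base \<psi> K" "x = \<psi> x *\<^sub>R b" "\<psi> x > 0"
    using normlike_base_decomposition[OF assms(1-3,6)] by blast
  have "f x = \<psi> x * f b"
    using b(2) linear_scale[OF assms(4), of "\<psi> x" b] by simp
  then show ?thesis
    using base[OF b(1)] b(3) by (simp add: mult.commute)
qed

theorem theorem5p2:
  fixes \<psi> :: "'a::real_topological_vector \<Rightarrow> real"
    and K A :: "'a set"
  assumes "seminorm \<psi>"
    and "nontrivial_cone K" and "has_normlike_base \<psi> K"
    and "nontrivial_cone A" and "has_normlike_base \<psi> A"
    and "(solid (S_neg \<psi> K) \<and> S_zero \<psi> A \<inter> interior (S_neg \<psi> K) = {}) \<or>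
         (solid (S_zero \<psi> A) \<and> interior (S_zero \<psi> A) \<inter> S_neg \<psi> K = {})"
  shows "\<exists>x' \<alpha>. (x', \<alpha>) \<in> topological_augmented_dual_cone \<psi> K \<and> x' \<noteq> (\<lambda>x. 0) \<and>
           (\<forall>a\<in>A. \<forall>k\<in>uminus ` K.
              x' a + \<alpha> * \<psi> a \<ge> 0 \<and> 0 \<ge> x' k + \<alpha> * \<psi> k)"
proof -
  have conv: "convex (S_neg \<psi> K)" "convex (S_zero \<psi> A)"
    by (simp_all add: S_neg_def S_zero_def)
  have sub: "uminus ` normlike_base \<psi> K \<subseteq> S_neg \<psi> K" "normlike_base \<psi> A \<union> {0} \<subseteq> S_zero \<psi> A"
    unfolding S_neg_def S_zero_def by (rule hull_subset)+
  have ne: "S_neg \<psi> K \<noteq> {}" "S_zero \<psi> A \<noteq> {}"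
    using sub normlike_base_nonempty[OF assms(1-3)] by auto
  have "\<exists>(f :: 'a \<Rightarrow> real) c. linear f \<and> continuous_on UNIV f \<and> f \<noteq> (\<lambda>x. 0) \<and>
      (\<forall>s\<in>S_neg \<psi> K. f s \<le> c) \<and> (\<forall>d\<in>S_zero \<psi> A. c \<le> f d)"
    using assms(6)
  proof
    assume "solid (S_neg \<psi> K) \<and> S_zero \<psi> A \<inter> interior (S_neg \<psi> K) = {}"
    then have "interior (S_neg \<psi> K) \<noteq> {}" "S_zero \<psi> A \<inter> interior (S_neg \<psi> K) = {}"
      by (simp_all add: solid_def)
    then show ?thesis
      by (rule separating_functional_interior[OF conv(1) _ conv(2) ne(2)]) blast
  next
    assume "solid (S_zero \<psi> A) \<and> interior (S_zero \<psi> A) \<inter> S_neg \<psi> K = {}"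
    then have "interior (S_zero \<psi> A) \<noteq> {}" "S_neg \<psi> K \<inter> interior (S_zero \<psi> A) = {}"
      by (auto simp: solid_def)
    \<comment> \<open>The solid set is now the other hull, so \<open>g\<close> separates in the
      opposite direction; negating \<open>g\<close> and \<open>b\<close> restores the
      orientation.\<close>
    then obtain g :: "'a \<Rightarrow> real" and b where g: "linear g" "continuous_on UNIV g" "g \<noteq> (\<lambda>x. 0)"
      "\<And>s. s \<in> S_zero \<psi> A \<Longrightarrow> g s \<le> b" "\<And>d. d \<in> S_neg \<psi> K \<Longrightarrow> b \<le> g d"
      by (rule separating_functional_interior[OF conv(2) _ conv(1) ne(1)]) blast
    show ?thesis
    proof (intro exI[of _ "\<lambda>x. - g x"] exI[of _ "- b"] conjI ballI)
      show "linear (\<lambda>x. - g x)"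
        by (rule linear_compose_neg[OF g(1)])
      show "continuous_on UNIV (\<lambda>x. - g x)"
        using g(2) by (rule continuous_on_minus)
      show "(\<lambda>x. - g x) \<noteq> (\<lambda>x. 0)"
        using g(3) by (auto simp: fun_eq_iff)
      show "- g s \<le> - b" if "s \<in> S_neg \<psi> K" for s
        using g(5)[OF that] by simp
      show "- b \<le> - g d" if "d \<in> S_zero \<psi> A" for d
        using g(4)[OF that] by simp
    qed
  qed
  then obtain f :: "'a \<Rightarrow> real" and c where f: "linear f" "continuous_on UNIV f" "f \<noteq> (\<lambda>x. 0)"
    and neg: "\<And>s. s \<in> S_neg \<psi> K \<Longrightarrow> f s \<le> c" and zero: "\<And>d. d \<in> S_zero \<psi> A \<Longrightarrow> c \<le> f d"
    by blast
  have c: "c \<le> 0"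
    using zero[of 0] sub(2) linear_0[OF f(1)] by auto
  have onA: "c * \<psi> a \<le> f a" if "a \<in> A" for a
    using that zero sub(2) by (intro linear_ge_on_cone_if_ge_on_base[OF assms(1,4,5) f(1)]) auto
  have "- c \<le> f b" if "b \<in> normlike_base \<psi> K" for b
    using neg[of "- b"] sub(1) that by (auto simp: linear_neg[OF f(1)])
  then have onK: "- c * \<psi> k \<le> f k" if "k \<in> K" for k
    using that by (intro linear_ge_on_cone_if_ge_on_base[OF assms(1-3) f(1)])
  have "\<psi> k \<ge> 0" if "k \<in> K" for k
    using that assms(3) seminorm_0[OF assms(1)]
    by (cases "k = 0") (auto simp: has_normlike_base_def intro: less_imp_le)
  \<comment> \<open>Membership in the dual cone comes from \<open>f k \<ge> - c * \<psi> k\<close>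
    with both factors on the right nonnegative.\<close>
  then have "f k \<ge> 0" if "k \<in> K" for k
    using that onK[OF that] c by (smt (verit) mult_nonneg_nonneg)
  then have "(f, - c) \<in> topological_augmented_dual_cone \<psi> K"
    using f c onK by (auto simp: topological_augmented_dual_cone_def augmented_dual_cone_def
        dual_cone_def topological_dual_def algebraic_dual_def)
  \<comment> \<open>Symmetry of \<open>\<psi>\<close> turns \<open>onK\<close> into the inequality
    on \<open>-K\<close>.\<close>
  moreover have "f (- k) + - c * \<psi> (- k) \<le> 0" if "k \<in> K" for k
    using onK[OF that] assms(1) by (simp add: seminorm_def linear_neg[OF f(1)])
  ultimately show ?thesis
    using f(3) onA by (intro exI[of _ f] exI[of _ "- c"]) auto
qed

end
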